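(* For all positive integers $m,n$, the number $C(m,n)$ of closed paths in the $m\times n$ plane grid with mirror boundary satisfies $C(m,n)=\gcd(m,n)-1$.
   Context: The $m\times n$ plane grid has point set $\{0,1,\dots,m\}\times\{0,1,\dots,n\}\subset\mathbb{Z}^2$; it consists of $mn$ unit squares, each with $2$ diagonals, so $2mn$ unit diagonals in total. The boundary of the rectangle $[0,m]\times[0,n]$ consists of mirrors. A beam of light travels along unit diagonals from grid point to grid point: at each step each coordinate changes by $+1$ or $-1$, and a coordinate reverses its direction of change exactly when it reaches $0$ or its maximum value ($m$, resp. $n$) (reflection in the mirror). The trajectories of such beams partition the set of all $2mn$ unit diagonals. A trajectory that passes through a corner (vertex) of the rectangle runs from one corner to another corner and is called an open path; every other trajectory is periodic and is called a closed path. $C(m,n)$ denotes the number of closed paths. *)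

theory Defs
  imports Complex_Main
begin

type_synonym point = "int \<times> int"

definition grid :: "nat \<Rightarrow> nat \<Rightarrow> point set" where
  "grid m n = {0..int m} \<times> {0..int n}"

definition corners :: "nat \<Rightarrow> nat \<Rightarrow> point set" where
  "corners m n = {0, int m} \<times> {0, int n}"

definition unit_diagonals :: "nat \<Rightarrow> nat \<Rightarrow> point set set" where
  "unit_diagonals m n =
     {{p, q} | p q. p \<in> grid m n \<and> q \<in> grid m n \<and>
        \<bar>fst q - fst p\<bar> = 1 \<and> \<bar>snd q - snd p\<bar> = 1}"

text \<open>One coordinate \<open>x\<close> as a function of time, with mirrors at \<open>0\<close> and \<open>a\<close>: its velocity
  changes sign at time \<open>k\<close> exactly when it is then at a mirror, and is unchanged otherwise.\<close>

definition mirrored :: "nat \<Rightarrow> (int \<Rightarrow> int) \<Rightarrow> bool" where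
  "mirrored a x \<longleftrightarrow>
     (\<forall>k. x (k + 1) - x k = (if x k \<in> {0, int a} then - (x k - x (k - 1)) else x k - x (k - 1)))"

text \<open>A beam is indexed by all integer times. In a corner both coordinates are reversed, so
  a beam that reaches a corner returns along the path on which it came.\<close>

definition beam :: "nat \<Rightarrow> nat \<Rightarrow> (int \<Rightarrow> point) \<Rightarrow> bool" where
  "beam m n p \<longleftrightarrow>
     (\<forall>k. {p k, p (k + 1)} \<in> unit_diagonals m n) \<and>
     mirrored m (\<lambda>k. fst (p k)) \<and> mirrored n (\<lambda>k. snd (p k))"

text \<open>A trajectory is the set of unit diagonals traversed by a beam, so neither the starting
  point nor the sense of travel matters.\<close>

definition trajectories :: "nat \<Rightarrow> nat \<Rightarrow> point set set set" where
  "trajectories m n = {range (\<lambda>k. {p k, p (k + 1)}) | p. beam m n p}"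

definition open_paths :: "nat \<Rightarrow> nat \<Rightarrow> point set set set" where
  "open_paths m n = {T \<in> trajectories m n. \<Union>T \<inter> corners m n \<noteq> {}}"

definition closed_paths :: "nat \<Rightarrow> nat \<Rightarrow> point set set set" where
  "closed_paths m n = trajectories m n - open_paths m n"

definition C :: "nat \<Rightarrow> nat \<Rightarrow> nat" where
  "C m n = card (closed_paths m n)"

end

theory Submission
  imports Defs
begin

text \<open>Unfolding the reflections, a coordinate with mirrors at \<open>0\<close> and \<open>a\<close> moves along the
  triangle wave of period \<open>2a\<close>. Hence up to a time shift every beam is
  \<open>k \<mapsto> (w\<^sub>m (k + d), w\<^sub>n k)\<close>, and only the phase difference \<open>d\<close> matters. The periods \<open>2m\<close> and
  \<open>2n\<close> of the coordinates make \<open>d\<close> matter only modulo \<open>2g\<close>, where \<open>g = gcd m n\<close>, and time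
  reversal identifies \<open>d\<close> with \<open>-d\<close>; so the trajectories are represented by \<open>0 \<le> d \<le> g\<close>. They
  are distinct since the trajectory of \<open>d\<close> contains the point \<open>(d, 0)\<close>, while each of its points
  \<open>(x, y)\<close> satisfies \<open>x - y \<equiv> \<plusminus>d\<close> or \<open>x + y \<equiv> \<plusminus>d\<close> modulo \<open>2g\<close>. A corner is reached iff \<open>g\<close>
  divides \<open>d\<close>, which leaves the closed paths \<open>0 < d < g\<close>.\<close>

section \<open>Triangle waves\<close>

text \<open>For \<open>a > 0\<close> this is the distance from \<open>t\<close> to the nearest
  multiple of \<open>2 * a\<close>: shifting by \<open>a\<close> before and after \<open>mod\<close>
  picks the residue in [-a, a).\<close>

definition triangle_wave :: "int \<Rightarrow> int \<Rightarrow> int" where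
  "triangle_wave a t = \<bar>(t + a) mod (2 * a) - a\<bar>"

lemma triangle_wave_bounds:
  assumes "a > 0"
  shows "0 \<le> triangle_wave a t" "triangle_wave a t \<le> a"
  using pos_mod_bound[of "2 * a" "t + a"] pos_mod_sign[of "2 * a" "t + a"] assms
  unfolding triangle_wave_def by linarith+

lemma triangle_wave_add_period [simp]: "triangle_wave a (t + 2 * a * j) = triangle_wave a t"
proof -
  have "(t + 2 * a * j + a) mod (2 * a) = (t + a + 2 * a * j) mod (2 * a)"
    by (simp add: algebra_simps)
  then show ?thesis by (simp only: triangle_wave_def mod_mult_self2)
qed

lemma triangle_wave_eq_abs:
  assumes "a > 0" "\<bar>t\<bar> \<le> a"
  shows "triangle_wave a t = \<bar>t\<bar>"
proof (cases "t = a")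
  case True
  then show ?thesis using assms by (simp add: triangle_wave_def)
next
  case False
  then show ?thesis using assms by (simp add: triangle_wave_def)
qed

lemma reduce_mod_period:
  fixes a t :: int
  assumes "a > 0"
  obtains r j where "t = r + 2 * a * j" "- a \<le> r" "r < a"
proof
  show "t = ((t + a) mod (2 * a) - a) + 2 * a * ((t + a) div (2 * a))"
    using mult_div_mod_eq[of "2 * a" "t + a"] by linarith
  show "- a \<le> (t + a) mod (2 * a) - a" "(t + a) mod (2 * a) - a < a"
    using pos_mod_bound[of "2 * a" "t + a"] pos_mod_sign[of "2 * a" "t + a"] assms by auto
qed

lemma triangle_wave_dvd:
  assumes "a > 0"
  shows "2 * a dvd t - triangle_wave a t \<or> 2 * a dvd t + triangle_wave a t"
proof -
  obtain r j where "t = r + 2 * a * j" "- a \<le> r" "r < a"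
    using reduce_mod_period[OF assms] .
  then show ?thesis using assms by (cases "r \<ge> 0") (auto simp: triangle_wave_eq_abs)
qed

lemma triangle_wave_minus [simp]:
  assumes "a > 0"
  shows "triangle_wave a (- t) = triangle_wave a t"
proof -
  obtain r j where r: "t = r + 2 * a * j" "- a \<le> r" "r < a"
    using reduce_mod_period[OF assms] .
  then have "triangle_wave a (- t) = triangle_wave a (- r + 2 * a * (- j))"
    by (simp add: algebra_simps)
  also have "\<dots> = triangle_wave a (- r)" by (rule triangle_wave_add_period)
  finally show ?thesis using r assms by (simp add: triangle_wave_eq_abs)
qed

text \<open>Converse of \<open>triangle_wave_dvd\<close>: together they identify the wave as the
  only value in [0, a] congruent to t or -t modulo 2a. Later arguments use this instead of the
  formula.\<close>

lemma triangle_wave_eqI: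
  assumes "a > 0" "0 \<le> r" "r \<le> a" "2 * a dvd t - r \<or> 2 * a dvd t + r"
  shows "triangle_wave a t = r"
proof -
  from assms(4) obtain j where "t - r = 2 * a * j \<or> t + r = 2 * a * j"
    by (auto simp: dvd_def)
  then have "t = r + 2 * a * j \<or> t = - r + 2 * a * j" by linarith
  then have "triangle_wave a t = triangle_wave a r \<or> triangle_wave a t = triangle_wave a (- r)"
    using triangle_wave_add_period by blast
  then show ?thesis using assms by (auto simp: triangle_wave_eq_abs)
qed

lemma triangle_wave_at_mirror_iff:
  assumes "a > 0"
  shows "triangle_wave a t \<in> {0, a} \<longleftrightarrow> a dvd t"
proof -
  obtain r j where r: "t = r + 2 * a * j" "- a \<le> r" "r < a"
    using reduce_mod_period[OF assms] .
  have "a dvd t \<longleftrightarrow> a dvd r" using r(1) by (simp add: dvd_add_left_iff)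
  also have "\<dots> \<longleftrightarrow> r = 0 \<or> r = - a"
    using r(2,3) zdvd_not_zless[of r a] zdvd_not_zless[of "- r" a] by fastforce
  finally show ?thesis using r assms by (auto simp: triangle_wave_eq_abs)
qed

lemma triangle_wave_step:
  assumes "a > 0"
  shows "\<bar>triangle_wave a (t + 1) - triangle_wave a t\<bar> = 1"
proof -
  obtain r j where r: "t = r + 2 * a * j" "- a \<le> r" "r < a"
    using reduce_mod_period[OF assms] .
  then have "triangle_wave a (t + 1) = triangle_wave a (r + 1)"
    using triangle_wave_add_period[of a "r + 1" j] by (simp add: algebra_simps)
  then show ?thesis using r assms by (simp add: triangle_wave_eq_abs)
qed

section \<open>Reflected coordinates are triangle waves\<close>

lemma mirrored_triangle_wave:
  assumes "a > 0"
  shows "mirrored a (\<lambda>k. triangle_wave (int a) (k + s))"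
  unfolding mirrored_def
proof
  fix k
  define b where "b = int a"
  have b: "b > 0" using assms b_def by simp
  obtain r j where r: "k + s = r + 2 * b * j" "- b \<le> r" "r < b"
    using reduce_mod_period[OF b] .
  have sh: "triangle_wave b (k + s + i) = triangle_wave b (r + i)" for i
    using r(1) triangle_wave_add_period[of b "r + i" j] by (simp add: algebra_simps)
  have 0: "triangle_wave b (k + s) = \<bar>r\<bar>"
    using sh[of 0] r b by (simp add: triangle_wave_eq_abs)
  have 1: "triangle_wave b (k + 1 + s) = \<bar>r + 1\<bar>"
    using sh[of 1] r b by (simp add: triangle_wave_eq_abs algebra_simps)
  \<comment> \<open>Only for \<open>r = - b\<close> does the previous phase leave [-b, b], where the
    wave is the absolute value; it wraps around to \<open>b - 1\<close>.\<close>
  have 2: "triangle_wave b (k - 1 + s) = (if r = - b then b - 1 else \<bar>r - 1\<bar>)"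
  proof (cases "r = - b")
    case True
    have "k - 1 + s = k + s + - 1" "r + - 1 + 2 * b * 1 = b - 1" using True by simp_all
    then have "triangle_wave b (k - 1 + s) = triangle_wave b (b - 1)"
      using sh[of "- 1"] triangle_wave_add_period[of b "r + - 1" 1] by metis
    then show ?thesis using True b by (simp add: triangle_wave_eq_abs)
  next
    case False
    then show ?thesis using sh[of "- 1"] r b by (simp add: triangle_wave_eq_abs algebra_simps)
  qed
  show "triangle_wave (int a) (k + 1 + s) - triangle_wave (int a) (k + s) =
     (if triangle_wave (int a) (k + s) \<in> {0, int a}
      then - (triangle_wave (int a) (k + s) - triangle_wave (int a) (k - 1 + s))
      else triangle_wave (int a) (k + s) - triangle_wave (int a) (k - 1 + s))"
    unfolding b_def[symmetric] 0 1 2 using r b by auto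
qed

text \<open>The reflection rule is a second-order recurrence that can also be solved for
  \<open>x (k - 1)\<close>, so two consecutive values determine the future and the past.\<close>

lemma mirrored_unique:
  assumes "mirrored a x" "mirrored a y" "x 0 = y 0" "x 1 = y 1"
  shows "x k = y k"
proof -
  have "x k = y k \<and> x (k + 1) = y (k + 1)"
  proof (induction k rule: int_induct[of _ 0])
    case base
    then show ?case using assms by simp
  next
    case (step1 i)
    then show ?case
      using assms(1,2)[unfolded mirrored_def, THEN spec, of "i + 1"] by (auto split: if_splits)
  next
    case (step2 i)
    then show ?case
      using assms(1,2)[unfolded mirrored_def, THEN spec, of i] by (auto split: if_splits)
  qed
  then show ?thesis ..
qed

lemma mirrored_eq_triangle_wave:
  assumes "mirrored a x" "\<bar>x 1 - x 0\<bar> = 1" "x 0 \<in> {0..int a}" "x 1 \<in> {0..int a}"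
  obtains s where "x = (\<lambda>k. triangle_wave (int a) (k + s))"
proof
  \<comment> \<open>A rising start lies on the branch \<open>t\<close> of the absolute value, a
    falling one on the branch \<open>- t\<close>.\<close>
  define s where "s = (if x 1 = x 0 + 1 then x 0 else - x 0)"
  have a: "a > 0" using assms by auto
  show "x = (\<lambda>k. triangle_wave (int a) (k + s))"
  proof
    fix k
    show "x k = triangle_wave (int a) (k + s)"
    proof (rule mirrored_unique[OF assms(1) mirrored_triangle_wave[OF a]])
      show "x 0 = triangle_wave (int a) (0 + s)" "x 1 = triangle_wave (int a) (1 + s)"
        using assms(2-4) a by (auto simp: s_def triangle_wave_eq_abs)
    qed
  qed
qed

section \<open>Beams as pairs of waves, up to time shift\<close>

definition wave :: "nat \<Rightarrow> nat \<Rightarrow> int \<Rightarrow> int \<Rightarrow> point" where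
  "wave m n d k = (triangle_wave (int m) (k + d), triangle_wave (int n) k)"

definition path :: "(int \<Rightarrow> point) \<Rightarrow> point set set" where
  "path p = range (\<lambda>k. {p k, p (k + 1)})"

lemma Union_path: "\<Union> (path p) = range p"
  by (auto simp: path_def)

lemma path_shift: "path (\<lambda>k. p (k + j)) = path p"
proof -
  have "range ((\<lambda>k. {p k, p (k + 1)}) \<circ> (\<lambda>k. k + j)) = path p"
    unfolding image_comp[symmetric] path_def by simp
  then show ?thesis by (simp add: path_def o_def algebra_simps)
qed

lemma path_reverse: "path (\<lambda>k. p (- k)) = path p"
proof -
  \<comment> \<open>Reversal sends the step from k to k + 1 to the one between -k - 1 and -k, so
    steps are reindexed by \<open>- k - 1\<close>, not \<open>- k\<close>.\<close>
  have "bij (\<lambda>k::int. - k - 1)" by (rule o_bij[of "\<lambda>k. - k - 1"]) auto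
  then have "range ((\<lambda>k. {p k, p (k + 1)}) \<circ> (\<lambda>k. - k - 1)) = path p"
    unfolding image_comp[symmetric] path_def by (simp add: bij_is_surj)
  then show ?thesis by (simp add: path_def o_def insert_commute)
qed

lemma beam_wave:
  assumes "m > 0" "n > 0"
  shows "beam m n (wave m n d)"
proof -
  have "mirrored n (triangle_wave (int n))"
    using mirrored_triangle_wave[OF assms(2), of 0] by simp
  moreover have "{wave m n d k, wave m n d (k + 1)} \<in> unit_diagonals m n" for k
    unfolding unit_diagonals_def wave_def grid_def
    using assms triangle_wave_step[of "int m" "k + d"] triangle_wave_step[of "int n" k]
    by (intro CollectI exI conjI refl) (auto simp: triangle_wave_bounds algebra_simps)
  ultimately show ?thesis
    unfolding beam_def using mirrored_triangle_wave[OF assms(1), of d] by (simp add: wave_def)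
qed

lemma path_beam:
  assumes "beam m n p"
  obtains d where "path p = path (wave m n d)"
proof -
  have "{p 0, p 1} \<in> unit_diagonals m n"
    using assms unfolding beam_def by (metis add_0)
  then have "p 0 \<in> grid m n" "p 1 \<in> grid m n"
    "\<bar>fst (p 1) - fst (p 0)\<bar> = 1" "\<bar>snd (p 1) - snd (p 0)\<bar> = 1"
    by (auto simp: unit_diagonals_def doubleton_eq_iff)
  then have steps: "\<bar>fst (p 1) - fst (p 0)\<bar> = 1" "fst (p 0) \<in> {0..int m}" "fst (p 1) \<in> {0..int m}"
    "\<bar>snd (p 1) - snd (p 0)\<bar> = 1" "snd (p 0) \<in> {0..int n}" "snd (p 1) \<in> {0..int n}"
    by (simp_all add: grid_def mem_Times_iff)
  have mirrored: "mirrored m (\<lambda>k. fst (p k))" "mirrored n (\<lambda>k. snd (p k))"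
    using assms by (auto simp: beam_def)
  obtain s where s: "(\<lambda>k. fst (p k)) = (\<lambda>k. triangle_wave (int m) (k + s))"
    by (rule mirrored_eq_triangle_wave[OF mirrored(1) steps(1-3)])
  obtain t where t: "(\<lambda>k. snd (p k)) = (\<lambda>k. triangle_wave (int n) (k + t))"
    by (rule mirrored_eq_triangle_wave[OF mirrored(2) steps(4-6)])
  from s t have "p = (\<lambda>k. wave m n (s - t) (k + t))"
    by (auto simp: wave_def fun_eq_iff prod_eq_iff)
  then have "path p = path (wave m n (s - t))" by (simp add: path_shift)
  then show thesis ..
qed

lemma trajectories_eq:
  assumes "m > 0" "n > 0"
  shows "trajectories m n = range (\<lambda>d. path (wave m n d))"
proof -
  have "trajectories m n = path ` {p. beam m n p}"
    by (auto simp: trajectories_def path_def)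
  also have "\<dots> = range (\<lambda>d. path (wave m n d))"
  proof
    show "path ` {p. beam m n p} \<subseteq> range (\<lambda>d. path (wave m n d))"
      using path_beam by blast
    show "range (\<lambda>d. path (wave m n d)) \<subseteq> path ` {p. beam m n p}"
      using beam_wave[OF assms] by blast
  qed
  finally show ?thesis .
qed

section \<open>Phase differences with the same trajectory\<close>

lemma path_wave_minus:
  assumes "m > 0" "n > 0"
  shows "path (wave m n (- d)) = path (wave m n d)"
proof -
  have "wave m n (- d) = (\<lambda>k. wave m n d (- k))"
  proof
    fix k
    show "wave m n (- d) k = wave m n d (- k)"
      using assms triangle_wave_minus[of "int m" "k - d"] by (simp add: wave_def)
  qed
  then show ?thesis by (simp add: path_reverse)
qed

lemma path_wave_cong:
  assumes "2 * gcd (int m) (int n) dvd d - e"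
  shows "path (wave m n d) = path (wave m n e)"
proof -
  obtain c where c: "d - e = 2 * gcd (int m) (int n) * c" using assms by (rule dvdE)
  obtain u v where "u * int m + v * int n = gcd (int m) (int n)"
    using bezout_int by blast
  \<comment> \<open>By Bezout the change of phase splits into a period of the first coordinate and a
    multiple of 2n. The latter becomes a time shift, which the second coordinate does not
    notice.\<close>
  then have d: "d = e + 2 * int n * (v * c) + 2 * int m * (u * c)"
    using c by (simp add: algebra_simps flip: distrib_left)
  have "wave m n d = (\<lambda>k. wave m n e (k + 2 * int n * (v * c)))"
  proof
    fix k
    show "wave m n d k = wave m n e (k + 2 * int n * (v * c))"
      using triangle_wave_add_period[of "int m" "k + e + 2 * int n * (v * c)" "u * c"]
        triangle_wave_add_period[of "int n" k "v * c"]
      unfolding wave_def d by (simp only: ac_simps)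
  qed
  then show ?thesis by (simp add: path_shift)
qed

text \<open>Folding \<open>d\<close> into [0, g] uses only a shift by a multiple of 2g and possibly
  a change of sign, both harmless.\<close>

lemma path_wave_reduce:
  assumes "m > 0" "n > 0"
  shows "path (wave m n (triangle_wave (gcd (int m) (int n)) d)) = path (wave m n d)"
proof -
  let ?g = "gcd (int m) (int n)"
  have "?g > 0" using assms by simp
  then have "2 * ?g dvd d - triangle_wave ?g d \<or> 2 * ?g dvd d - (- triangle_wave ?g d)"
    using triangle_wave_dvd[of ?g d] by simp
  then show ?thesis
    using path_wave_cong[of m n d] path_wave_minus[OF assms] by blast
qed

section \<open>Separating the trajectories\<close>

lemma wave_invariant:
  fixes d :: int
  assumes "m > 0" "n > 0" "0 \<le> d" "d \<le> gcd (int m) (int n)" "(x, y) \<in> range (wave m n d)"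
  shows "triangle_wave (gcd (int m) (int n)) (x - y) = d \<or>
    triangle_wave (gcd (int m) (int n)) (x + y) = d"
proof -
  let ?g = "gcd (int m) (int n)"
  have g: "?g > 0" using assms by simp
  obtain k where xy: "x = triangle_wave (int m) (k + d)" "y = triangle_wave (int n) k"
    using assms(5) by (auto simp: wave_def)
  have dvd: "2 * ?g dvd 2 * int m" "2 * ?g dvd 2 * int n" by simp_all
  have "2 * int m dvd k + d - x \<or> 2 * int m dvd k + d + x"
    using triangle_wave_dvd[of "int m" "k + d"] assms(1) xy by simp
  then obtain i where "k + d - x = 2 * ?g * i \<or> k + d + x = 2 * ?g * i"
    using dvd_trans[OF dvd(1)] by (meson dvdE)
  moreover have "2 * int n dvd k - y \<or> 2 * int n dvd k + y"
    using triangle_wave_dvd[of "int n" k] assms(2) xy by simp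
  then obtain j where "k - y = 2 * ?g * j \<or> k + y = 2 * ?g * j"
    using dvd_trans[OF dvd(2)] by (meson dvdE)
  \<comment> \<open>Modulo 2g, x is k + d or its negative and y is k or its negative. Equal signs
    cancel k in x - y, opposite signs in x + y.\<close>
  ultimately have "(x - y) - d = 2 * ?g * (j - i) \<or> (x - y) + d = 2 * ?g * (i - j) \<or>
    (x + y) - d = 2 * ?g * (j - i) \<or> (x + y) + d = 2 * ?g * (i - j)"
    unfolding right_diff_distrib by smt
  then have "2 * ?g dvd (x - y) - d \<or> 2 * ?g dvd (x - y) + d \<or>
    2 * ?g dvd (x + y) - d \<or> 2 * ?g dvd (x + y) + d"
    by (elim disjE) simp_all
  then show ?thesis using triangle_wave_eqI[OF g assms(3,4)] by blast
qed

lemma inj_on_path_wave: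
  assumes "m > 0" "n > 0"
  shows "inj_on (\<lambda>d. path (wave m n d)) {0..gcd (int m) (int n)}"
proof (rule inj_onI)
  let ?g = "gcd (int m) (int n)"
  fix d e
  assume d: "d \<in> {0..?g}" and e: "e \<in> {0..?g}"
    and eq: "path (wave m n d) = path (wave m n e)"
  have g: "?g > 0" "?g \<le> int m" using assms by (simp_all add: zdvd_imp_le)
  have "d \<le> int m" using d g(2) by simp
  then have "wave m n d 0 = (d, 0)"
    using d g assms triangle_wave_eq_abs[of "int m" d] triangle_wave_eq_abs[of "int n" 0]
    by (simp add: wave_def)
  then have "(d, 0) \<in> range (wave m n e)" using eq by (metis Union_path rangeI)
  \<comment> \<open>At (d, 0) the sum and the difference agree, so both alternatives of the
    invariant say the same.\<close>
  then have "triangle_wave ?g d = e"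
    using wave_invariant[of m n e d 0] assms e by auto
  then show "d = e" using d g by (simp add: triangle_wave_eq_abs)
qed

section \<open>Corners and the count\<close>

lemma wave_meets_corner_iff:
  assumes "m > 0" "n > 0"
  shows "range (wave m n d) \<inter> corners m n \<noteq> {} \<longleftrightarrow> gcd (int m) (int n) dvd d"
proof -
  let ?g = "gcd (int m) (int n)"
  have "wave m n d k \<in> corners m n \<longleftrightarrow> int m dvd k + d \<and> int n dvd k" for k
    using triangle_wave_at_mirror_iff[of "int m" "k + d"]
      triangle_wave_at_mirror_iff[of "int n" k] assms
    unfolding wave_def corners_def mem_Times_iff by simp
  then have "range (wave m n d) \<inter> corners m n \<noteq> {} \<longleftrightarrow> (\<exists>k. int m dvd k + d \<and> int n dvd k)"
    by blast
  also have "\<dots> \<longleftrightarrow> ?g dvd d"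
  proof
    assume "\<exists>k. int m dvd k + d \<and> int n dvd k"
    then obtain k where "int m dvd k + d" "int n dvd k" by blast
    then have "?g dvd k + d" "?g dvd k" using dvd_trans gcd_dvd1 gcd_dvd2 by blast+
    then show "?g dvd d" by (simp add: dvd_add_right_iff)
  next
    assume "?g dvd d"
    then obtain c where c: "d = ?g * c" by (rule dvdE)
    obtain u v where uv: "u * int m + v * int n = ?g" using bezout_int by blast
    \<comment> \<open>The time -nvc puts the second coordinate at a mirror, and Bezout makes the
      phase of the first a multiple of m.\<close>
    have "- (int n * (v * c)) + d = int m * (u * c)"
      unfolding c uv[symmetric] by (simp add: algebra_simps)
    then show "\<exists>k. int m dvd k + d \<and> int n dvd k"
      by (intro exI[of _ "- (int n * (v * c))"]) simp
  qed
  finally show ?thesis .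
qed

lemma closed_paths_eq:
  assumes "m > 0" "n > 0"
  shows "closed_paths m n = (\<lambda>d. path (wave m n d)) ` {0<..<gcd (int m) (int n)}"
proof -
  let ?g = "gcd (int m) (int n)" and ?T = "\<lambda>d. path (wave m n d)"
  have g: "?g > 0" using assms by simp
  have "trajectories m n = ?T ` {0..?g}"
  proof -
    have "?T d \<in> ?T ` {0..?g}" for d
      using path_wave_reduce[OF assms, of d] triangle_wave_bounds[OF g, of d]
      by (metis atLeastAtMost_iff imageI)
    then show ?thesis unfolding trajectories_eq[OF assms] by auto
  qed
  then have "closed_paths m n = {T \<in> ?T ` {0..?g}. \<not> \<Union> T \<inter> corners m n \<noteq> {}}"
    unfolding closed_paths_def open_paths_def by blast
  also have "\<dots> = ?T ` {d \<in> {0..?g}. \<not> \<Union> (?T d) \<inter> corners m n \<noteq> {}}"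
    by (rule Compr_image_eq)
  also have "\<dots> = ?T ` {d \<in> {0..?g}. \<not> ?g dvd d}"
    unfolding Union_path wave_meets_corner_iff[OF assms] ..
  \<comment> \<open>The endpoints 0 and g, which represent the open paths, are the only multiples of
    g in the range.\<close>
  also have "{d \<in> {0..?g}. \<not> ?g dvd d} = {0<..<?g}"
    using zdvd_not_zless by (force simp: order.order_iff_strict)
  finally show ?thesis .
qed

theorem theorem1p3:
  fixes m n :: nat
  assumes "m > 0" and "n > 0"
  shows "C m n = gcd m n - 1"
proof -
  have "inj_on (\<lambda>d. path (wave m n d)) {0<..<gcd (int m) (int n)}"
    by (rule inj_on_subset[OF inj_on_path_wave[OF assms]]) auto
  then have "C m n = card {0<..<gcd (int m) (int n)}"
    unfolding C_def closed_paths_eq[OF assms] by (rule card_image)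
  also have "\<dots> = gcd m n - 1" by (simp add: nat_diff_distrib)
  finally show ?thesis .
qed

end
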